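(* Let $(S,\Phi,f)$ be a dynamic programming problem: $S$ is a set of states, $\Phi$ is a correspondence from $S$ to itself with nonempty values, and $f:S\to[0,1]$ is a payoff function. For $n\ge 1$ let $v_n(s)$ be the value of the $n$-stage program $G_n(s)$ starting from $s\in S$. Assume the problem is regular, i.e. $v(s)=\lim_{n\to\infty}v_n(s)$ exists for each $s\in S$ and the convergence of $v_n$ to $v$ is uniform on $S$. Then for every $\varepsilon>0$ there exists $n_0$ such that for all $n\ge n_0$, for every state $s\in S$, every feasible play $\{s_m\}_{m\ge1}$ at $s$ that is $\varepsilon$-optimal for $G_n(s)$, and every $t\in[0,1]$, $$3\varepsilon\;\ge\;\frac1n\Big(\sum_{m=1}^{[tn]}f(s_m)\Big)-t\,v(s)\;\ge\;-3\varepsilon,$$ where $[tn]$ denotes the integer part of $tn$.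
   Context: A feasible play at $s\in S$ is a sequence $\{s_m\}_{m\ge1}$ of states with $s_1=s$ and $s_{m+1}\in\Phi(s_m)$ for all $m\ge1$. The $n$-stage program $G_n(s)$ consists of maximizing $\frac1n\sum_{m=1}^n f(s_m)$ over feasible plays at $s$, and its value is $v_n(s)=\sup\frac1n\sum_{m=1}^n f(s_m)$, the supremum being over all feasible plays at $s$. A feasible play $\{s_m\}$ at $s$ is $\varepsilon$-optimal for $G_n(s)$ if $\frac1n\sum_{m=1}^n f(s_m)\ge v_n(s)-\varepsilon$. An empty sum is $0$. *)

theory Defs
  imports "HOL-Analysis.Analysis"
begin

definition dynamic_programming_problem ::
    "'a set \<Rightarrow> ('a \<Rightarrow> 'a set) \<Rightarrow> ('a \<Rightarrow> real) \<Rightarrow> bool" where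
  "dynamic_programming_problem S \<Phi> f \<longleftrightarrow>
     (\<forall>s\<in>S. \<Phi> s \<subseteq> S \<and> \<Phi> s \<noteq> {}) \<and> (\<forall>s\<in>S. 0 \<le> f s \<and> f s \<le> 1)"

(* Plays are indexed from 1; the entry at index 0 is unconstrained and never used. A feasible play
   at a state of S stays in S, because the values of \<Phi> on S are subsets of S. *)
definition feasible_play :: "('a \<Rightarrow> 'a set) \<Rightarrow> 'a \<Rightarrow> (nat \<Rightarrow> 'a) \<Rightarrow> bool" where
  "feasible_play \<Phi> s p \<longleftrightarrow> p 1 = s \<and> (\<forall>m\<ge>1. p (m + 1) \<in> \<Phi> (p m))"

definition average_payoff :: "('a \<Rightarrow> real) \<Rightarrow> nat \<Rightarrow> (nat \<Rightarrow> 'a) \<Rightarrow> real" where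
  "average_payoff f n p = 1 / real n * (\<Sum>m=1..n. f (p m))"

(* For s in S and n >= 1 the supremum is over a nonempty subset of [0,1], so the real-valued
   operator SUP is the genuine supremum. *)
definition stage_value :: "('a \<Rightarrow> 'a set) \<Rightarrow> ('a \<Rightarrow> real) \<Rightarrow> nat \<Rightarrow> 'a \<Rightarrow> real" where
  "stage_value \<Phi> f n s = (SUP p\<in>{p. feasible_play \<Phi> s p}. average_payoff f n p)"

definition eps_optimal_play ::
    "('a \<Rightarrow> 'a set) \<Rightarrow> ('a \<Rightarrow> real) \<Rightarrow> real \<Rightarrow> nat \<Rightarrow> 'a \<Rightarrow> (nat \<Rightarrow> 'a) \<Rightarrow> bool" where
  "eps_optimal_play \<Phi> f \<epsilon> n s p \<longleftrightarrow>
     feasible_play \<Phi> s p \<and> average_payoff f n p \<ge> stage_value \<Phi> f n s - \<epsilon>"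

definition limit_value :: "('a \<Rightarrow> 'a set) \<Rightarrow> ('a \<Rightarrow> real) \<Rightarrow> 'a \<Rightarrow> real" where
  "limit_value \<Phi> f s = lim (\<lambda>n. stage_value \<Phi> f n s)"

definition regular_problem ::
    "'a set \<Rightarrow> ('a \<Rightarrow> 'a set) \<Rightarrow> ('a \<Rightarrow> real) \<Rightarrow> bool" where
  "regular_problem S \<Phi> f \<longleftrightarrow>
     (\<forall>s\<in>S. convergent (\<lambda>n. stage_value \<Phi> f n s)) \<and>
     uniform_limit S (\<lambda>n s. stage_value \<Phi> f n s) (limit_value \<Phi> f) sequentially"

end

theory Submission
  imports Defs
begin

text \<open>The limit value is nonincreasing along feasible plays, because a play at a successor of
  \<open>s\<close> can be prefixed by \<open>s\<close> at the cost of one stage. Uniform convergence therefore bounds every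
  block of \<open>k\<close> consecutive payoffs of a feasible play at \<open>s\<close> by \<open>k v(s)\<close>, up to an error that is
  small compared with \<open>n\<close>. Applied to the first \<open>[tn]\<close> stages this is the upper bound; applied to
  the remaining \<open>n - [tn]\<close> stages and subtracted from the total payoff, which is at least
  \<open>n (v\<^sub>n(s) - \<epsilon>)\<close>, it is the lower bound.\<close>

section \<open>Shifting and extending plays\<close>

lemma feasible_play_tail:
  assumes "feasible_play \<Phi> s p"
  shows "feasible_play \<Phi> (p (k + 1)) (\<lambda>m. p (m + k))"
  using assms by (auto simp: feasible_play_def add.commute add.left_commute)

lemma feasible_play_Cons:
  assumes "feasible_play \<Phi> s' q" "s' \<in> \<Phi> s"
  shows "feasible_play \<Phi> s (\<lambda>m. if m \<le> 1 then s else q (m - 1))"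
  unfolding feasible_play_def
proof (intro conjI allI impI)
  fix m :: nat assume "1 \<le> m"
  then obtain j where "m = Suc j" by (cases m) auto
  \<comment> \<open>For \<open>j = 0\<close> this is the new transition from \<open>s\<close> to
    \<open>q 1 = s'\<close>; for larger \<open>j\<close> it is a transition of
    \<open>q\<close>.\<close>
  then show "(if m + 1 \<le> 1 then s else q (m + 1 - 1)) \<in> \<Phi> (if m \<le> 1 then s else q (m - 1))"
    using assms by (cases j) (auto simp: feasible_play_def)
qed simp

text \<open>Clearing the denominator is valid at \<open>n = 0\<close> too, where both sides are 0.
  Read from right to left, this turns block sums into averages that can be compared with stage
  values.\<close>

lemma average_payoff_sum: "real n * average_payoff f n p = (\<Sum>m=1..n. f (p m))"
  by (cases "n = 0") (simp_all add: average_payoff_def)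

context
  fixes S :: "'a set" and \<Phi> :: "'a \<Rightarrow> 'a set" and f :: "'a \<Rightarrow> real"
  assumes dp: "dynamic_programming_problem S \<Phi> f"
begin

lemma payoff_bounds: "s \<in> S \<Longrightarrow> 0 \<le> f s" "s \<in> S \<Longrightarrow> f s \<le> 1"
  using dp by (auto simp: dynamic_programming_problem_def)

text \<open>Iterating a choice function for \<open>\<Phi>\<close> gives a play. This makes the set
  under the supremum in \<open>stage_value\<close> nonempty.\<close>

lemma feasible_play_exists:
  assumes "s \<in> S"
  shows "\<exists>p. feasible_play \<Phi> s p"
proof -
  define next_state where "next_state s = (SOME s'. s' \<in> \<Phi> s)" for s
  have succ: "next_state s \<in> \<Phi> s \<and> next_state s \<in> S" if "s \<in> S" for s
  proof -
    have "\<Phi> s \<noteq> {}" "\<Phi> s \<subseteq> S"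
      using dp that by (auto simp: dynamic_programming_problem_def)
    then show ?thesis
      unfolding next_state_def by (metis some_in_eq subsetD)
  qed
  have orbit: "(next_state ^^ m) s \<in> S" for m
    by (induction m) (use assms succ in auto)
  \<comment> \<open>The exponent is \<open>m - 1\<close> because plays start at index 1.\<close>
  have "feasible_play \<Phi> s (\<lambda>m. (next_state ^^ (m - 1)) s)"
    unfolding feasible_play_def
  proof (intro conjI allI impI)
    fix m :: nat assume "1 \<le> m"
    then have "m = Suc (m - 1)" by simp
    then have "(next_state ^^ m) s = next_state ((next_state ^^ (m - 1)) s)"
      by (metis comp_apply funpow.simps(2))
    then show "(next_state ^^ (m + 1 - 1)) s \<in> \<Phi> ((next_state ^^ (m - 1)) s)"
      using succ orbit by simp
  qed simp
  then show ?thesis by blast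
qed

lemma feasible_play_in:
  assumes "feasible_play \<Phi> s p" "s \<in> S" "1 \<le> m"
  shows "p m \<in> S"
  using assms(3)
proof (induction m rule: dec_induct)
  case base
  then show ?case using assms by (simp add: feasible_play_def)
next
  case (step m)
  then have "p (Suc m) \<in> \<Phi> (p m)" using assms by (simp add: feasible_play_def)
  then show ?case using step dp by (auto simp: dynamic_programming_problem_def)
qed

lemma partial_sum_bounds:
  assumes "feasible_play \<Phi> s p" "s \<in> S"
  shows "0 \<le> (\<Sum>m=1..n. f (p m))" "(\<Sum>m=1..n. f (p m)) \<le> real n"
proof -
  have in_S: "p m \<in> S" if "m \<in> {1..n}" for m
    using feasible_play_in[OF assms] that by simp
  show "0 \<le> (\<Sum>m=1..n. f (p m))"
    by (intro sum_nonneg payoff_bounds in_S)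
  show "(\<Sum>m=1..n. f (p m)) \<le> real n"
    using sum_bounded_above[of "{1..n}" "\<lambda>m. f (p m)" 1] payoff_bounds(2) in_S by simp
qed

lemma average_payoff_bounds:
  assumes "feasible_play \<Phi> s p" "s \<in> S"
  shows "0 \<le> average_payoff f n p" "average_payoff f n p \<le> 1"
proof -
  show "0 \<le> average_payoff f n p"
    using partial_sum_bounds(1)[OF assms] by (simp add: average_payoff_def)
  show "average_payoff f n p \<le> 1"
    using partial_sum_bounds(2)[OF assms, of n]
    by (cases "n = 0") (simp_all add: average_payoff_def divide_simps)
qed

section \<open>Stage values as suprema of bounded nonempty sets\<close>

lemma average_payoff_le_stage_value:
  assumes "feasible_play \<Phi> s p" "s \<in> S"
  shows "average_payoff f n p \<le> stage_value \<Phi> f n s"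
  unfolding stage_value_def
proof (rule cSUP_upper)
  show "bdd_above (average_payoff f n ` {p. feasible_play \<Phi> s p})"
    by (rule bdd_aboveI[of _ 1]) (use average_payoff_bounds(2) assms(2) in auto)
qed (use assms in simp)

lemma stage_value_le:
  assumes "s \<in> S" "\<And>p. feasible_play \<Phi> s p \<Longrightarrow> average_payoff f n p \<le> c"
  shows "stage_value \<Phi> f n s \<le> c"
  unfolding stage_value_def
  by (rule cSUP_least) (use assms feasible_play_exists in auto)

lemma stage_value_bounds:
  assumes "s \<in> S"
  shows "0 \<le> stage_value \<Phi> f n s" "stage_value \<Phi> f n s \<le> 1"
proof -
  obtain p where p: "feasible_play \<Phi> s p"
    using feasible_play_exists assms by blast
  show "0 \<le> stage_value \<Phi> f n s"
    using average_payoff_bounds(1)[OF p assms] average_payoff_le_stage_value[OF p assms]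
    by (rule order_trans)
  show "stage_value \<Phi> f n s \<le> 1"
    by (rule stage_value_le) (use assms average_payoff_bounds(2) in auto)
qed

text \<open>Prefixing \<open>s\<close> to a play at \<open>s'\<close> does not lower the total
  payoff, since \<open>f s\<close> is nonnegative, but lengthens the play by one stage. The error
  \<open>1 / real n\<close> is the price of that stage.\<close>

lemma stage_value_successor:
  assumes "s \<in> S" "s' \<in> \<Phi> s" "0 < n"
  shows "stage_value \<Phi> f n s' \<le> stage_value \<Phi> f (Suc n) s + 1 / real n"
proof (rule stage_value_le)
  show "s' \<in> S"
    using assms dp by (auto simp: dynamic_programming_problem_def)
next
  fix q assume q: "feasible_play \<Phi> s' q"
  define p where "p = (\<lambda>m. if m \<le> 1 then s else q (m - 1))"
  have p: "feasible_play \<Phi> s p"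
    unfolding p_def using feasible_play_Cons[OF q assms(2)] .
  have "(\<Sum>m=1..Suc n. f (p m)) = f s + (\<Sum>m=1..n. f (q m))"
    unfolding p_def
    by (subst sum.atLeast_Suc_atMost, simp)
       (simp add: sum.atLeast_Suc_atMost_Suc_shift del: sum.cl_ivl_Suc)
  then have "real n * average_payoff f n q \<le> real (Suc n) * average_payoff f (Suc n) p"
    unfolding average_payoff_sum using payoff_bounds(1)[OF assms(1)] by simp
  also have "\<dots> \<le> real (Suc n) * stage_value \<Phi> f (Suc n) s"
    using average_payoff_le_stage_value[OF p assms(1)] by (intro mult_left_mono) auto
  \<comment> \<open>The extra copy of the stage value, from \<open>Suc n\<close> against
    \<open>n\<close>, is at most 1.\<close>
  also have "\<dots> \<le> real n * stage_value \<Phi> f (Suc n) s + 1"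
    using stage_value_bounds(2)[OF assms(1), of "Suc n"] by (simp add: algebra_simps)
  finally show "average_payoff f n q \<le> stage_value \<Phi> f (Suc n) s + 1 / real n"
    using assms(3) by (simp add: field_simps)
qed

section \<open>The limit value of a regular problem and its control of partial sums\<close>

context
  assumes reg: "regular_problem S \<Phi> f"
begin

lemma stage_value_tendsto:
  "s \<in> S \<Longrightarrow> (\<lambda>n. stage_value \<Phi> f n s) \<longlonglongrightarrow> limit_value \<Phi> f s"
  using reg by (simp add: regular_problem_def limit_value_def convergent_LIMSEQ_iff)

lemma limit_value_bounds:
  assumes "s \<in> S"
  shows "0 \<le> limit_value \<Phi> f s" "limit_value \<Phi> f s \<le> 1"
  using LIMSEQ_le_const[OF stage_value_tendsto[OF assms]]
    LIMSEQ_le_const2[OF stage_value_tendsto[OF assms]] stage_value_bounds[OF assms] by auto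

lemma limit_value_successor:
  assumes "s \<in> S" "s' \<in> \<Phi> s"
  shows "limit_value \<Phi> f s' \<le> limit_value \<Phi> f s"
proof (rule LIMSEQ_le)
  have "s' \<in> S"
    using assms dp by (auto simp: dynamic_programming_problem_def)
  then show "(\<lambda>n. stage_value \<Phi> f n s') \<longlonglongrightarrow> limit_value \<Phi> f s'"
    by (rule stage_value_tendsto)
  \<comment> \<open>Neither the index shift nor the vanishing term \<open>1 / real n\<close> changes
    the limit.\<close>
  show "(\<lambda>n. stage_value \<Phi> f (Suc n) s + 1 / real n) \<longlonglongrightarrow> limit_value \<Phi> f s"
    using tendsto_add[OF LIMSEQ_Suc[OF stage_value_tendsto[OF assms(1)]] lim_1_over_n] by simp
  show "\<exists>N. \<forall>n\<ge>N. stage_value \<Phi> f n s' \<le> stage_value \<Phi> f (Suc n) s + 1 / real n"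
    using stage_value_successor[OF assms] by (intro exI[of _ 1]) auto
qed

lemma limit_value_play:
  assumes "feasible_play \<Phi> s p" "s \<in> S" "1 \<le> m"
  shows "limit_value \<Phi> f (p m) \<le> limit_value \<Phi> f s"
  using assms(3)
proof (induction m rule: dec_induct)
  case base
  then show ?case using assms by (simp add: feasible_play_def)
next
  case (step m)
  have "p (Suc m) \<in> \<Phi> (p m)"
    using assms step by (simp add: feasible_play_def)
  then show ?case
    using limit_value_successor feasible_play_in[OF assms(1,2)] step by force
qed

text \<open>For \<open>k \<ge> N\<close> the average over \<open>k\<close> stages is at most the
  \<open>k\<close>-stage value, which is within \<open>\<delta>\<close> above the limit. For
  \<open>k < N\<close> no such estimate is available, but payoffs are at most 1, so the sum is below
  \<open>N\<close>. Stating the error as \<open>\<delta> * real n\<close> instead of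
  \<open>\<delta> * real k\<close> covers both cases.\<close>

lemma partial_sum_le_limit_value:
  assumes p: "feasible_play \<Phi> s p" "s \<in> S"
    and N: "\<And>n. N \<le> n \<Longrightarrow> stage_value \<Phi> f n s \<le> limit_value \<Phi> f s + \<delta>"
    and "0 \<le> \<delta>" "k \<le> n" "real N \<le> \<delta> * real n"
  shows "(\<Sum>m=1..k. f (p m)) \<le> real k * limit_value \<Phi> f s + \<delta> * real n"
proof (cases "N \<le> k")
  case True
  have "(\<Sum>m=1..k. f (p m)) \<le> real k * (limit_value \<Phi> f s + \<delta>)"
    unfolding average_payoff_sum[symmetric]
    using average_payoff_le_stage_value[OF p] N[OF True]
    by (intro mult_left_mono) (auto intro: order_trans)
  also have "\<dots> \<le> real k * limit_value \<Phi> f s + \<delta> * real n"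
    using assms mult_left_mono[of "real k" "real n" \<delta>] by (simp add: algebra_simps)
  finally show ?thesis .
next
  case False
  then have "(\<Sum>m=1..k. f (p m)) \<le> \<delta> * real n"
    using partial_sum_bounds(2)[OF p, of k] assms by linarith
  then show ?thesis
    using limit_value_bounds(1)[OF p(2)] by (simp add: add_increasing)
qed

text \<open>The lower bound is the total minus the tail: the total loses \<open>\<epsilon>\<close>
  by near-optimality and \<open>\<delta>\<close> by convergence, the tail another
  \<open>\<delta>\<close>. The threshold \<open>N\<close> must serve all states, since the tail
  starts at the unknown state \<open>p (k + 1)\<close>.\<close>

lemma eps_optimal_partial_sum_bounds:
  assumes opt: "eps_optimal_play \<Phi> f \<epsilon> n s p" and s: "s \<in> S"
    and N: "\<And>n s. N \<le> n \<Longrightarrow> s \<in> S \<Longrightarrow> \<bar>stage_value \<Phi> f n s - limit_value \<Phi> f s\<bar> \<le> \<delta>"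
    and "0 \<le> \<delta>" "k \<le> n" "N \<le> n" "real N \<le> \<delta> * real n"
  shows "(\<Sum>m=1..k. f (p m)) \<le> real k * limit_value \<Phi> f s + \<delta> * real n"
    and "real k * limit_value \<Phi> f s - (2 * \<delta> + \<epsilon>) * real n \<le> (\<Sum>m=1..k. f (p m))"
proof -
  let ?v = "limit_value \<Phi> f"
  have p: "feasible_play \<Phi> s p"
    and total: "stage_value \<Phi> f n s - \<epsilon> \<le> average_payoff f n p"
    using opt by (auto simp: eps_optimal_play_def)
  have N': "stage_value \<Phi> f n s \<le> ?v s + \<delta>" if "N \<le> n" "s \<in> S" for n s
    using N[OF that] by linarith
  show "(\<Sum>m=1..k. f (p m)) \<le> real k * ?v s + \<delta> * real n"
    by (rule partial_sum_le_limit_value[OF p s N']) (use assms in auto)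
  have tail_state: "p (k + 1) \<in> S"
    using feasible_play_in[OF p s] by simp
  \<comment> \<open>The horizon in the error stays \<open>n\<close>, so a tail shorter than
    \<open>N\<close> is covered as well.\<close>
  have "(\<Sum>m=1..n-k. f (p (m + k))) \<le> real (n - k) * ?v (p (k + 1)) + \<delta> * real n"
    by (rule partial_sum_le_limit_value[OF feasible_play_tail[OF p] tail_state N'])
       (use assms tail_state in auto)
  \<comment> \<open>Monotonicity along the play replaces the limit value at the tail's start by the
    one at \<open>s\<close>.\<close>
  also have "\<dots> \<le> real (n - k) * ?v s + \<delta> * real n"
    using limit_value_play[OF p s, of "k + 1"] \<open>0 \<le> \<delta>\<close> by (intro add_mono mult_left_mono) auto
  finally have tail: "(\<Sum>m=1..n-k. f (p (m + k))) \<le> real (n - k) * ?v s + \<delta> * real n" .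
  have split: "(\<Sum>m=1..n. f (p m)) = (\<Sum>m=1..k. f (p m)) + (\<Sum>m=1..n-k. f (p (m + k)))"
    using sum.ub_add_nat[of 1 k "\<lambda>m. f (p m)" "n - k"]
      sum.shift_bounds_cl_nat_ivl[of "\<lambda>m. f (p m)" 1 k "n - k"] \<open>k \<le> n\<close>
    by (simp add: add.commute)
  have "real n * (?v s - \<delta> - \<epsilon>) \<le> (\<Sum>m=1..n. f (p m))"
    unfolding average_payoff_sum[symmetric]
    using total N[OF \<open>N \<le> n\<close> s] by (intro mult_left_mono) auto
  then show "real k * ?v s - (2 * \<delta> + \<epsilon>) * real n \<le> (\<Sum>m=1..k. f (p m))"
    using tail split \<open>k \<le> n\<close> by (simp add: of_nat_diff algebra_simps)
qed

lemma stage_value_uniform: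
  assumes "0 < \<delta>"
  shows "\<exists>N. \<forall>n\<ge>N. \<forall>s\<in>S. \<bar>stage_value \<Phi> f n s - limit_value \<Phi> f s\<bar> \<le> \<delta>"
proof -
  have "\<forall>\<^sub>F n in sequentially. \<forall>s\<in>S. dist (stage_value \<Phi> f n s) (limit_value \<Phi> f s) < \<delta>"
    using reg assms by (auto simp: regular_problem_def uniform_limit_iff)
  then show ?thesis
    by (force simp: eventually_sequentially dist_real_def)
qed

end

end

theorem theorem3p1:
  fixes S :: "'a set" and \<Phi> :: "'a \<Rightarrow> 'a set" and f :: "'a \<Rightarrow> real"
  assumes "dynamic_programming_problem S \<Phi> f"
    and "regular_problem S \<Phi> f"
  shows "\<forall>\<epsilon>>0. \<exists>n0\<ge>1. \<forall>n\<ge>n0. \<forall>s\<in>S. \<forall>p. eps_optimal_play \<Phi> f \<epsilon> n s p \<longrightarrow>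
    (\<forall>t\<in>{0..1}.
       3 * \<epsilon> \<ge> 1 / real n * (\<Sum>m=1..nat \<lfloor>t * real n\<rfloor>. f (p m)) - t * limit_value \<Phi> f s \<and>
       1 / real n * (\<Sum>m=1..nat \<lfloor>t * real n\<rfloor>. f (p m)) - t * limit_value \<Phi> f s \<ge> - 3 * \<epsilon>)"
proof (intro allI impI)
  fix \<epsilon> :: real assume \<epsilon>: "0 < \<epsilon>"
  \<comment> \<open>With \<open>\<delta> = \<epsilon> / 2\<close> the lower error
    \<open>2 * \<delta> + \<epsilon>\<close> is \<open>2 * \<epsilon>\<close>, leaving one
    \<open>\<epsilon>\<close> for rounding \<open>t * real n\<close> down to an integer.\<close>
  obtain N where N: "\<And>n s. N \<le> n \<Longrightarrow> s \<in> S \<Longrightarrow>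
      \<bar>stage_value \<Phi> f n s - limit_value \<Phi> f s\<bar> \<le> \<epsilon> / 2"
    using stage_value_uniform[OF assms, of "\<epsilon> / 2"] \<epsilon> by auto
  \<comment> \<open>\<open>Suc N\<close> ensures \<open>N \<le> n\<close> and \<open>0 < n\<close>.
    The second summand yields both \<open>real N \<le> \<epsilon> / 2 * real n\<close>, for short
    blocks, and \<open>1 \<le> \<epsilon> * real n\<close>, for the rounding.\<close>
  define n0 where "n0 = Suc N + nat \<lceil>real (2 * N + 1) / \<epsilon>\<rceil>"
  have large: "real (2 * N + 1) \<le> \<epsilon> * real n" if "n0 \<le> n" for n
  proof -
    have "real (2 * N + 1) / \<epsilon> \<le> real n0"
      unfolding n0_def by linarith
    also have "\<dots> \<le> real n"
      using that by simp
    finally show ?thesis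
      using \<epsilon> by (simp add: field_simps)
  qed
  have bounds: "1 / real n * (\<Sum>m=1..nat \<lfloor>t * real n\<rfloor>. f (p m)) - t * limit_value \<Phi> f s \<le> 3 * \<epsilon> \<and>
      - 3 * \<epsilon> \<le> 1 / real n * (\<Sum>m=1..nat \<lfloor>t * real n\<rfloor>. f (p m)) - t * limit_value \<Phi> f s"
    if n: "n0 \<le> n" and s: "s \<in> S" and opt: "eps_optimal_play \<Phi> f \<epsilon> n s p"
      and t: "t \<in> {0..1}" for n s p t
  proof -
    define k where "k = nat \<lfloor>t * real n\<rfloor>"
    let ?v = "limit_value \<Phi> f s"
    have "0 \<le> t * real n" "t * real n \<le> real n"
      using t by (auto simp: mult_left_le_one_le)
    then have k: "real k \<le> t * real n" "t * real n \<le> real k + 1" "k \<le> n"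
      unfolding k_def by linarith+
    have "N \<le> n" "0 < n"
      using n by (auto simp: n0_def)
    have v: "0 \<le> ?v" "?v \<le> 1"
      using limit_value_bounds[OF assms s] by auto
    have \<delta>: "0 \<le> \<epsilon> / 2" "real N \<le> \<epsilon> / 2 * real n"
      using \<epsilon> large[OF n] by auto
    have sum: "(\<Sum>m=1..k. f (p m)) \<le> real k * ?v + \<epsilon> / 2 * real n"
      "real k * ?v - (2 * (\<epsilon> / 2) + \<epsilon>) * real n \<le> (\<Sum>m=1..k. f (p m))"
      by (rule eps_optimal_partial_sum_bounds[OF assms opt s N]; use \<delta> k \<open>N \<le> n\<close> in simp)+
    \<comment> \<open>Since \<open>?v\<close> lies in [0,1], replacing \<open>k\<close> by
      \<open>t * real n\<close> changes the product by at most 1.\<close>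
    have "real k * ?v \<le> t * real n * ?v" "t * real n * ?v \<le> real k * ?v + 1"
      using mult_right_mono[OF k(1) v(1)] mult_right_mono[OF k(2) v(1)] v(2)
      by (auto simp: algebra_simps)
    moreover have "1 \<le> \<epsilon> * real n"
      using large[OF n] by simp
    \<comment> \<open>The lower error is \<open>2 * \<epsilon>\<close> plus the rounding, hence
      \<open>3 * \<epsilon>\<close>; above, rounding down only helps and
      \<open>\<epsilon> / 2\<close> suffices.\<close>
    ultimately have "(\<Sum>m=1..k. f (p m)) \<le> (t * ?v + 3 * \<epsilon>) * real n"
      "(t * ?v - 3 * \<epsilon>) * real n \<le> (\<Sum>m=1..k. f (p m))"
      using sum by (auto simp: algebra_simps)
    then show ?thesis
      unfolding k_def[symmetric] using \<open>0 < n\<close> by (simp add: field_simps)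
  qed
  show "\<exists>n0\<ge>1. \<forall>n\<ge>n0. \<forall>s\<in>S. \<forall>p. eps_optimal_play \<Phi> f \<epsilon> n s p \<longrightarrow>
    (\<forall>t\<in>{0..1}.
       3 * \<epsilon> \<ge> 1 / real n * (\<Sum>m=1..nat \<lfloor>t * real n\<rfloor>. f (p m)) - t * limit_value \<Phi> f s \<and>
       1 / real n * (\<Sum>m=1..nat \<lfloor>t * real n\<rfloor>. f (p m)) - t * limit_value \<Phi> f s \<ge> - 3 * \<epsilon>)"
    by (intro exI[of _ n0] conjI) (use bounds in \<open>auto simp: n0_def\<close>)
qed

end
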